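(* For any positive integer $n$, the quandle Euler characteristic of the discrete $n$-sphere $DS^n$ satisfies $\chi^{\mathrm{Qdle}}(DS^n)=\chi^{\mathrm{Top}}(S^n)$, that is, $$\chi^{\mathrm{Qdle}}(DS^n)=\begin{cases}0 & \text{if } n \text{ is odd},\\ 2 & \text{if } n \text{ is even}.\end{cases}$$
   Context: A quandle is a pair $(X,s)$ of a non-empty set $X$ and a map $s : X \to \mathrm{Map}(X,X)$, $x \mapsto s_x$ (where $\mathrm{Map}(X,X)$ is the set of all maps $X\to X$) such that: (1) $s_x(x)=x$ for all $x\in X$; (2) each $s_x$ is a bijection; (3) $s_x\circ s_y = s_{s_x(y)}\circ s_x$ for all $x,y\in X$. The displacement group $\mathrm{Dis}(X)$ is the group of bijections of $X$ generated under composition by $\{s_x\circ s_y^{-1} \mid x,y\in X\}$. For $g\in \mathrm{Dis}(X)$, $\mathrm{Fix}(g,X)=\{x\in X\mid g(x)=x\}$. The quandle Euler characteristic is $\chi^{\mathrm{Qdle}}(X)=\inf\{\#\mathrm{Fix}(g,X)\mid g\in \mathrm{Dis}(X)\}$, where $\#$ denotes cardinality. $\chi^{\mathrm{Top}}$ denotes the usual topological Euler characteristic. The unit sphere $S^n\subset\mathbb{R}^{n+1}$ is a quandle with $s_p(x)=2\langle x,p\rangle p-x$, where $\langle\cdot,\cdot\rangle$ is the standard inner product. Let $e_1,\dots,e_{n+1}$ be the standard basis of $\mathbb{R}^{n+1}$. The discrete $n$-sphere is the subquandle $DS^n=\{\pm e_1,\dots,\pm e_{n+1}\}$ of $S^n$,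 with the quandle structure restricted from $S^n$; explicitly $s_{e_i}=s_{-e_i}$, $s_{e_i}(\pm e_i)=\pm e_i$, and $s_{e_i}(\pm e_j)=\mp e_j$ for $i\neq j$. *)

theory Defs
  imports
    "HOL-Homology.Homology"
    "HOL-Algebra.Bij"
    "HOL-Algebra.Generated_Groups"
    "HOL-Library.Extended_Real"
begin

section \<open>Quandles and their Euler characteristic\<close>

locale quandle =
  fixes X :: "'a set" and s :: "'a \<Rightarrow> 'a \<Rightarrow> 'a"
  assumes nonempty: "X \<noteq> {}"
    and sym_self: "x \<in> X \<Longrightarrow> s x x = x"
    and sym_bij: "x \<in> X \<Longrightarrow> bij_betw (s x) X X"
    and sym_distrib: "\<lbrakk>x \<in> X; y \<in> X; z \<in> X\<rbrakk> \<Longrightarrow> s x (s y z) = s (s x y) (s x z)"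

text \<open>
  The elements of \<^term>\<open>BijGroup X\<close> are extensional functions, so the symmetries are restricted
  to \<^term>\<open>X\<close>; the values of \<^term>\<open>s\<close> outside \<^term>\<open>X\<close> play no role.
\<close>

definition displacement_group :: "'a set \<Rightarrow> ('a \<Rightarrow> 'a \<Rightarrow> 'a) \<Rightarrow> ('a \<Rightarrow> 'a) set" where
  "displacement_group X s =
     generate (BijGroup X)
       {restrict (s x) X \<otimes>\<^bsub>BijGroup X\<^esub> inv\<^bsub>BijGroup X\<^esub> (restrict (s y) X) | x y. x \<in> X \<and> y \<in> X}"

definition fixed_points :: "('a \<Rightarrow> 'a) \<Rightarrow> 'a set \<Rightarrow> 'a set" where
  "fixed_points g X = {x \<in> X. g x = x}"

text \<open>Unlike \<^const>\<open>card\<close>, this does not send infinite sets to zero.\<close>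

definition ecard :: "'a set \<Rightarrow> enat" where
  "ecard A = (if finite A then enat (card A) else \<infinity>)"

definition quandle_euler_char :: "'a set \<Rightarrow> ('a \<Rightarrow> 'a \<Rightarrow> 'a) \<Rightarrow> enat" where
  "quandle_euler_char X s = (INF g \<in> displacement_group X s. ecard (fixed_points g X))"

section \<open>The sphere and the discrete sphere\<close>

text \<open>
  As in \<^const>\<open>nsphere\<close>, a point of Euclidean \<open>(n+1)\<close>-space is a function \<^typ>\<open>nat \<Rightarrow> real\<close>
  vanishing outside \<^term>\<open>{..n}\<close>; the coordinates are thus numbered from \<open>0\<close> to \<open>n\<close>.
\<close>

definition sphere_sym :: "nat \<Rightarrow> (nat \<Rightarrow> real) \<Rightarrow> (nat \<Rightarrow> real) \<Rightarrow> (nat \<Rightarrow> real)" where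
  "sphere_sym n p x = (\<lambda>i. 2 * (\<Sum>j\<le>n. x j * p j) * p i - x i)"

definition basis_vec :: "nat \<Rightarrow> (nat \<Rightarrow> real)" where
  "basis_vec i = (\<lambda>j. if j = i then 1 else 0)"

definition neg_basis_vec :: "nat \<Rightarrow> (nat \<Rightarrow> real)" where
  "neg_basis_vec i = (\<lambda>j. - basis_vec i j)"

definition discrete_sphere :: "nat \<Rightarrow> (nat \<Rightarrow> real) set" where
  "discrete_sphere n = basis_vec ` {..n} \<union> neg_basis_vec ` {..n}"

lemma sphere_sym_basis:
  assumes "i \<le> n"
  shows "sphere_sym n (basis_vec i) = sphere_sym n (neg_basis_vec i)"
    and "sphere_sym n (basis_vec i) (basis_vec i) = basis_vec i"
    and "sphere_sym n (basis_vec i) (neg_basis_vec i) = neg_basis_vec i"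
    and "j \<noteq> i \<Longrightarrow> sphere_sym n (basis_vec i) (basis_vec j) = neg_basis_vec j"
    and "j \<noteq> i \<Longrightarrow> sphere_sym n (basis_vec i) (neg_basis_vec j) = basis_vec j"
  using assms
  by (auto simp: sphere_sym_def basis_vec_def neg_basis_vec_def fun_eq_iff
        if_distrib[where f = "\<lambda>t. _ * t"] sum_negf cong: if_cong)

lemma in_sphere_iff:
  "x \<in> topspace (nsphere n) \<longleftrightarrow> (\<Sum>i\<le>n. x i * x i) = 1 \<and> (\<forall>i>n. x i = 0)"
  by (auto simp: nsphere power2_eq_square)

lemma sphere_sym_inner:
  assumes "p \<in> topspace (nsphere n)"
  shows "(\<Sum>i\<le>n. sphere_sym n p x i * sphere_sym n p y i) = (\<Sum>i\<le>n. x i * y i)"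
proof -
  define a where "a = (\<Sum>j\<le>n. x j * p j)"
  define b where "b = (\<Sum>j\<le>n. y j * p j)"
  have pp: "(\<Sum>i\<le>n. p i * p i) = 1"
    using assms by (simp add: in_sphere_iff)
  have "(\<Sum>i\<le>n. sphere_sym n p x i * sphere_sym n p y i)
      = (\<Sum>i\<le>n. 4*a*b*(p i * p i) - 2*a*(y i * p i) - 2*b*(x i * p i) + x i * y i)"
    unfolding sphere_sym_def a_def[symmetric] b_def[symmetric]
    by (intro sum.cong refl) (simp add: algebra_simps)
  also have "\<dots> = 4*a*b*(\<Sum>i\<le>n. p i * p i) - 2*a*(\<Sum>i\<le>n. y i * p i)
      - 2*b*(\<Sum>i\<le>n. x i * p i) + (\<Sum>i\<le>n. x i * y i)"
    by (simp only: sum.distrib sum_subtractf sum_distrib_left)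
  also have "\<dots> = (\<Sum>i\<le>n. x i * y i)"
    unfolding pp a_def[symmetric] b_def[symmetric] by simp
  finally show ?thesis .
qed

lemma sphere_sym_in_sphere:
  assumes "p \<in> topspace (nsphere n)" "x \<in> topspace (nsphere n)"
  shows "sphere_sym n p x \<in> topspace (nsphere n)"
  using assms sphere_sym_inner[OF assms(1), of x x]
  unfolding in_sphere_iff by (simp add: sphere_sym_def)

lemma sphere_sym_self:
  assumes "p \<in> topspace (nsphere n)"
  shows "sphere_sym n p p = p"
  using assms by (simp add: sphere_sym_def in_sphere_iff)

lemma sphere_sym_linear:
  "sphere_sym n p (\<lambda>i. c * x i - y i) = (\<lambda>i. c * sphere_sym n p x i - sphere_sym n p y i)"
  by (simp add: sphere_sym_def fun_eq_iff algebra_simps sum_subtractf sum_distrib_left)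

lemma sphere_sym_distrib:
  assumes "p \<in> topspace (nsphere n)"
  shows "sphere_sym n p (sphere_sym n q x) = sphere_sym n (sphere_sym n p q) (sphere_sym n p x)"
proof -
  have "sphere_sym n p (sphere_sym n q x)
      = (\<lambda>i. 2 * (\<Sum>j\<le>n. x j * q j) * sphere_sym n p q i - sphere_sym n p x i)"
    by (subst (2) sphere_sym_def) (rule sphere_sym_linear)
  also have "\<dots> = sphere_sym n (sphere_sym n p q) (sphere_sym n p x)"
    by (subst (3) sphere_sym_def) (simp only: sphere_sym_inner[OF assms])
  finally show ?thesis .
qed

lemma sphere_sym_involution:
  assumes "p \<in> topspace (nsphere n)"
  shows "sphere_sym n p (sphere_sym n p x) = x"
proof -
  have "(\<Sum>j\<le>n. sphere_sym n p x j * p j) = (\<Sum>j\<le>n. x j * p j)"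
    using sphere_sym_inner[OF assms, of x p] by (simp add: sphere_sym_self[OF assms])
  then have "sphere_sym n p (sphere_sym n p x)
      = (\<lambda>i. 2 * (\<Sum>j\<le>n. x j * p j) * p i - sphere_sym n p x i)"
    by (simp only: sphere_sym_def[of n p "sphere_sym n p x"])
  then show ?thesis
    by (simp add: sphere_sym_def[of n p x])
qed

lemma discrete_sphere_subset: "discrete_sphere n \<subseteq> topspace (nsphere n)"
  by (auto simp: discrete_sphere_def in_sphere_iff basis_vec_def neg_basis_vec_def
        if_distrib[where f = "\<lambda>t. _ * t"] sum_negf cong: if_cong)

lemma sphere_sym_in_discrete_sphere:
  assumes "p \<in> discrete_sphere n" "x \<in> discrete_sphere n"
  shows "sphere_sym n p x \<in> discrete_sphere n"
proof -
  obtain i where i: "i \<le> n" "p = basis_vec i \<or> p = neg_basis_vec i"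
    using assms(1) by (auto simp: discrete_sphere_def)
  obtain j where j: "j \<le> n" "x = basis_vec j \<or> x = neg_basis_vec j"
    using assms(2) by (auto simp: discrete_sphere_def)
  have "sphere_sym n p x = x" if "j = i"
    using i(2) j(2) sphere_sym_basis(1-3)[OF i(1)] that by metis
  moreover have "sphere_sym n p x \<in> {basis_vec j, neg_basis_vec j}" if "j \<noteq> i"
    using i(2) j(2) sphere_sym_basis(1,4,5)[OF i(1)] that by (metis insert_iff)
  moreover have "{basis_vec j, neg_basis_vec j} \<subseteq> discrete_sphere n"
    using j(1) by (auto simp: discrete_sphere_def)
  ultimately show ?thesis
    using assms(2) by (cases "j = i") auto
qed

lemma quandle_subset_sphere:
  assumes "A \<noteq> {}" "A \<subseteq> topspace (nsphere n)"
    and closed: "\<And>p x. \<lbrakk>p \<in> A; x \<in> A\<rbrakk> \<Longrightarrow> sphere_sym n p x \<in> A"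
  shows "quandle A (sphere_sym n)"
proof
  fix p assume p: "p \<in> A"
  with assms have ps: "p \<in> topspace (nsphere n)" by blast
  show "sphere_sym n p p = p" by (rule sphere_sym_self[OF ps])
  show "bij_betw (sphere_sym n p) A A"
    by (rule bij_betw_byWitness[where f' = "sphere_sym n p"])
      (auto simp: sphere_sym_involution[OF ps] intro: closed p)
  show "sphere_sym n p (sphere_sym n q x) = sphere_sym n (sphere_sym n p q) (sphere_sym n p x)"
    for q x by (rule sphere_sym_distrib[OF ps])
qed (rule assms(1))

lemma quandle_sphere: "quandle (topspace (nsphere n)) (sphere_sym n)"
proof (rule quandle_subset_sphere)
  show "topspace (nsphere n) \<noteq> {}" using in_topspace_nsphere by blast
qed (rule subset_refl, rule sphere_sym_in_sphere)

lemma quandle_discrete_sphere: "quandle (discrete_sphere n) (sphere_sym n)"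
proof (rule quandle_subset_sphere)
  show "discrete_sphere n \<noteq> {}" by (auto simp: discrete_sphere_def)
qed (rule discrete_sphere_subset, rule sphere_sym_in_discrete_sphere)

section \<open>The topological Euler characteristic\<close>

text \<open>Linear independence over the integers in a commutative group, written multiplicatively.\<close>

definition int_independent :: "('a, 'b) monoid_scheme \<Rightarrow> 'a set \<Rightarrow> bool" where
  "int_independent G B \<longleftrightarrow> finite B \<and> B \<subseteq> carrier G \<and>
     (\<forall>c :: 'a \<Rightarrow> int. finprod G (\<lambda>b. b [^]\<^bsub>G\<^esub> c b) B = \<one>\<^bsub>G\<^esub> \<longrightarrow> (\<forall>b \<in> B. c b = 0))"

definition abelian_rank :: "('a, 'b) monoid_scheme \<Rightarrow> enat" where
  "abelian_rank G = (SUP B \<in> {B. int_independent G B}. enat (card B))"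

definition betti_number :: "nat \<Rightarrow> 'a topology \<Rightarrow> enat" where
  "betti_number k X = abelian_rank (homology_group (int k) X)"

text \<open>
  Meaningful when all Betti numbers are finite and only finitely many of them are nonzero;
  the sum then has finite support.
\<close>

definition top_euler_char :: "'a topology \<Rightarrow> int" where
  "top_euler_char X = (\<Sum>k | betti_number k X \<noteq> 0. (-1) ^ k * int (the_enat (betti_number k X)))"

end

theory Submission
  imports Defs
begin

text \<open>
  Everything rests on one description of the displacement group. The symmetry at \<open>\<pm>e\<^sub>i\<close> is the
  sign change of all coordinates other than \<open>i\<close>. Sign changes are involutions, and they compose by
  symmetric difference of the sets of negated coordinates. A generator
  \<open>s\<^sub>p \<circ> s\<^sub>q\<^sup>-\<^sup>1\<close> with \<open>p = \<pm>e\<^sub>i\<close> and \<open>q = \<pm>e\<^sub>j\<close> therefore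
  negates exactly the coordinates \<open>i\<close> and \<open>j\<close> (and is the identity if \<open>i = j\<close>). Symmetric
  differences preserve the parity of the number of negated coordinates, and every set of even size
  splits into pairs, so the displacement group consists of the sign changes of the sets
  \<open>A\<close> of even size (\<open>displacement_group_discrete_sphere\<close>).

  The fixed points of such a sign change are the vectors \<open>\<pm>e\<^sub>i\<close> with \<open>i \<notin> A\<close>. If \<open>n\<close> is odd, the
  number \<open>n + 1\<close> of coordinates is even, all of them can be negated and nothing stays fixed.
  If \<open>n\<close> is even, one coordinate must be spared, and sparing just one leaves two fixed points.

  On the topological side, the only nontrivial homology groups of the sphere of dimension
  \<open>n \<ge> 1\<close> are those in degrees \<open>0\<close> and \<open>n\<close>, both infinite cyclic. Its Euler characteristic is hence
  \<open>1 + (-1)^n\<close>, once the rank has been shown to be invariant under isomorphism, to be \<open>1\<close> for the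
  integers, and to vanish for the trivial group. The known computation of the reduced homology of
  spheres covers degree \<open>n\<close> directly; for degree \<open>0\<close>, the map to a point is surjective on homology
  and has the reduced group as its kernel, which is trivial.
\<close>

section \<open>Ranks of abelian groups\<close>

lemma hom_finprod:
  assumes G: "comm_group G" and H: "comm_group H" and h: "h \<in> hom G H" and f: "f \<in> A \<rightarrow> carrier G"
  shows "h (finprod G f A) = finprod H (\<lambda>a. h (f a)) A"
proof -
  interpret G: comm_group G by (rule G)
  interpret H: comm_group H by (rule H)
  interpret group_hom G H h
    by (simp add: group_hom_def group_hom_axioms_def G.group_axioms H.group_axioms h)
  show ?thesis
    using f
  proof (induction A rule: infinite_finite_induct)
    case (insert a A)
    then have "f \<in> A \<rightarrow> carrier G" "f a \<in> carrier G" by auto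
    with insert show ?case by (auto simp: Pi_iff)
  qed auto
qed

text \<open>
  A relation among the images pulls back to a relation in \<open>G\<close>: its left-hand side is the image
  of an element of \<open>G\<close>, which an injective homomorphism sends to the unit only if it is the unit.
\<close>

lemma int_independent_image:
  fixes G :: "('a, 'm) monoid_scheme" and H :: "('b, 'k) monoid_scheme"
  assumes G: "comm_group G" and H: "comm_group H" and h: "h \<in> mon G H" and B: "int_independent G B"
  shows "int_independent H (h ` B)" and "card (h ` B) = card B"
proof -
  interpret G: comm_group G by (rule G)
  interpret H: comm_group H by (rule H)
  have hom: "h \<in> hom G H" and inj: "inj_on h (carrier G)"
    using h by (auto simp: mon_def)
  have fin: "finite B" and BG: "B \<subseteq> carrier G"
    using B by (auto simp: int_independent_def)
  have hc: "h x \<in> carrier H" if "x \<in> carrier G" for x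
    using hom that by (rule hom_in_carrier)
  have injB: "inj_on h B"
    using inj BG by (rule inj_on_subset)
  show "card (h ` B) = card B"
    using injB by (rule card_image)
  have "\<forall>b \<in> h ` B. c b = 0"
    if c: "finprod H (\<lambda>b. b [^]\<^bsub>H\<^esub> c b) (h ` B) = \<one>\<^bsub>H\<^esub>" for c :: "'b \<Rightarrow> int"
  proof -
    have closed: "(\<lambda>b. b [^]\<^bsub>G\<^esub> c (h b)) \<in> B \<rightarrow> carrier G"
      using BG by auto
    have "h (finprod G (\<lambda>b. b [^]\<^bsub>G\<^esub> c (h b)) B) = finprod H (\<lambda>b. h (b [^]\<^bsub>G\<^esub> c (h b))) B"
      by (rule hom_finprod[OF G H hom closed])
    also have "\<dots> = finprod H (\<lambda>b. h b [^]\<^bsub>H\<^esub> c (h b)) B"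
      using BG hc by (intro H.finprod_cong')
        (auto simp: hom_int_pow[OF hom _ G.group_axioms H.group_axioms])
    also have "\<dots> = finprod H (\<lambda>b. b [^]\<^bsub>H\<^esub> c b) (h ` B)"
      using BG hc by (intro H.finprod_reindex[symmetric] injB) auto
    also have "\<dots> = h \<one>\<^bsub>G\<^esub>"
      using c hom_one[OF hom G.group_axioms H.group_axioms] by simp
    finally have "finprod G (\<lambda>b. b [^]\<^bsub>G\<^esub> c (h b)) B = \<one>\<^bsub>G\<^esub>"
      using inj_onD[OF inj _ G.finprod_closed[OF closed] G.one_closed] by blast
    then show ?thesis
      using B unfolding int_independent_def by (auto dest: spec[where x = "\<lambda>b. c (h b)"])
  qed
  then show "int_independent H (h ` B)"
    using fin BG hc unfolding int_independent_def by auto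
qed

lemma abelian_rank_le_of_mon:
  assumes "comm_group G" "comm_group H" "h \<in> mon G H"
  shows "abelian_rank G \<le> abelian_rank H"
  unfolding abelian_rank_def
proof (rule SUP_least)
  fix B assume "B \<in> {B. int_independent G B}"
  then have "int_independent H (h ` B)" "card (h ` B) = card B"
    using int_independent_image[OF assms] by auto
  then show "enat (card B) \<le> (SUP B \<in> {B. int_independent H B}. enat (card B))"
    by (metis (mono_tags, lifting) SUP_upper mem_Collect_eq)
qed

lemma abelian_rank_iso:
  assumes G: "comm_group G" and H: "comm_group H" and "G \<cong> H"
  shows "abelian_rank G = abelian_rank H"
proof -
  obtain h where h: "h \<in> iso G H"
    using assms(3) by (auto simp: is_iso_def)
  then have "inv_into (carrier G) h \<in> iso H G"
    using G by (intro group.iso_set_sym) (auto simp: comm_group_def)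
  with h show ?thesis
    using abelian_rank_le_of_mon[OF G H] abelian_rank_le_of_mon[OF H G]
    by (meson antisym iso_iff_mon_epi)
qed

lemma abelian_rank_trivial:
  assumes "comm_group G" "trivial_group G"
  shows "abelian_rank G = 0"
proof -
  interpret comm_group G by (rule assms(1))
  have "B = {}" if B: "int_independent G B" for B
  proof -
    have "B \<subseteq> {\<one>\<^bsub>G\<^esub>}"
      using B assms(2) by (auto simp: int_independent_def trivial_group_def)
    then have "finprod G (\<lambda>b. b [^]\<^bsub>G\<^esub> (1::int)) B = \<one>\<^bsub>G\<^esub>"
      by (intro finprod_one_eqI) auto
    then have "\<forall>b\<in>B. (1::int) = 0"
      using B unfolding int_independent_def by (auto dest: spec[where x = "\<lambda>_. 1"])
    then show ?thesis by auto
  qed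
  then have "(SUP B \<in> {B. int_independent G B}. enat (card B)) \<le> 0"
    by (intro SUP_least) (metis card.empty mem_Collect_eq order_refl zero_enat_def)
  then show ?thesis
    by (simp add: abelian_rank_def)
qed

lemma finprod_integer_group:
  "finprod integer_group f A = sum f A"
proof -
  interpret comm_group integer_group by (rule abelian_integer_group)
  show ?thesis
    by (induction A rule: infinite_finite_induct) auto
qed

text \<open>Any two integers \<open>a\<close> and \<open>b\<close> satisfy the relation \<open>b * a + (- a) * b = 0\<close>.\<close>

lemma abelian_rank_integer_group: "abelian_rank integer_group = 1"
proof -
  have "card B \<le> 1" if B: "int_independent integer_group B" for B
  proof -
    have fin: "finite B"
      and ind: "\<And>c. (\<Sum>b\<in>B. c b * b) = 0 \<Longrightarrow> \<forall>b\<in>B. c b = 0"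
      using B by (auto simp: int_independent_def finprod_integer_group)
    have "a = b" if ab: "a \<in> B" "b \<in> B" for a b
    proof (rule ccontr)
      assume ne: "a \<noteq> b"
      \<comment> \<open>This relation is nontrivial, since distinct integers are not both zero.\<close>
      define c where "c = (\<lambda>x. if x = a then b else if x = b then - a else 0)"
      have "(\<Sum>x\<in>B. c x * x) = (\<Sum>x\<in>{a, b}. c x * x)"
        using fin ab by (intro sum.mono_neutral_right) (auto simp: c_def)
      also have "\<dots> = 0"
        using ne by (simp add: c_def)
      finally have "\<forall>x\<in>B. c x = 0" by (rule ind)
      then have "c a = 0" "c b = 0" using ab by blast+
      then show False using ne by (auto simp: c_def split: if_splits)
    qed
    then show ?thesis
      by (metis One_nat_def card_le_Suc0_iff_eq fin)
  qed
  then have "abelian_rank integer_group \<le> 1"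
    unfolding abelian_rank_def by (intro SUP_least) (auto simp: one_enat_def)
  moreover have "int_independent integer_group {1}"
    by (auto simp: int_independent_def finprod_integer_group)
  then have "enat (card {1::int}) \<le> abelian_rank integer_group"
    unfolding abelian_rank_def by (intro SUP_upper) simp
  ultimately show ?thesis
    by (simp add: one_enat_def)
qed

section \<open>The topological Euler characteristic of the sphere\<close>

text \<open>
  The reduced homology group is the kernel of the map induced by \<open>X \<rightarrow> {()}\<close>, and that map is
  surjective on homology because a point is a retract of every nonempty space.
\<close>

lemma homology_group_0_of_trivial_reduced:
  assumes X: "topspace X \<noteq> {}" and triv: "trivial_group (reduced_homology_group 0 X)"
  shows "homology_group 0 X \<cong> integer_group"
proof -
  let ?P = "discrete_topology {()}"
  let ?h = "hom_induced 0 X {} ?P {} (\<lambda>x. ())"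
  obtain a where a: "a \<in> topspace X" using X by blast
  have "retraction_maps X ?P (\<lambda>x. ()) (\<lambda>x. a)"
    using a by (auto simp: retraction_maps_def)
  then have "?h \<in> epi (homology_group 0 X) (homology_group 0 ?P)"
    by (intro epi_hom_induced_retraction_map) (auto simp: retraction_map_def)
  moreover have "kernel (homology_group 0 X) (homology_group 0 ?P) ?h = {\<one>\<^bsub>homology_group 0 X\<^esub>}"
    using triv by (simp add: trivial_group_def carrier_reduced_homology_group one_reduced_homology_group)
  ultimately have "?h \<in> iso (homology_group 0 X) (homology_group 0 ?P)"
    by (simp add: iso_kernel_image epi_def)
  then have "homology_group 0 X \<cong> homology_group 0 ?P"
    by (auto simp: is_iso_def)
  also have "\<dots> \<cong> integer_group"
    by (rule homology_coefficients[of _ "()"]) simp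
  finally show ?thesis .
qed

lemma betti_number_nsphere:
  assumes "n \<ge> 1"
  shows "betti_number k (nsphere n) = (if k = 0 \<or> k = n then 1 else 0)"
proof -
  have eq1: "betti_number k (nsphere n) = 1" if "homology_group (int k) (nsphere n) \<cong> integer_group"
    using abelian_rank_iso[OF abelian_homology_group abelian_integer_group that]
    by (simp add: betti_number_def abelian_rank_integer_group)
  consider "k = 0" | "k = n" "k \<noteq> 0" | "k \<noteq> 0" "k \<noteq> n" by blast
  then show ?thesis
  proof cases
    case 1
    have "topspace (nsphere n) \<noteq> {}"
      using in_topspace_nsphere by blast
    moreover have "trivial_group (reduced_homology_group 0 (nsphere n))"
      using assms by (intro reduced_homology_group_nsphere(2)) simp
    ultimately have "homology_group 0 (nsphere n) \<cong> integer_group"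
      by (rule homology_group_0_of_trivial_reduced)
    then show ?thesis
      using 1 eq1 by simp
  next
    case 2
    then show ?thesis
      using eq1 reduced_homology_group_nsphere(1)[of n] by (simp add: un_reduced_homology_group)
  next
    case 3
    then have "trivial_group (homology_group (int k) (nsphere n))"
      using reduced_homology_group_nsphere(2)[of "int k" n] by (simp add: un_reduced_homology_group)
    then show ?thesis
      using 3 by (simp add: betti_number_def abelian_rank_trivial[OF abelian_homology_group])
  qed
qed

lemma top_euler_char_nsphere:
  assumes "n \<ge> 1"
  shows "top_euler_char (nsphere n) = (if odd n then 0 else 2)"
proof -
  have "{k. betti_number k (nsphere n) \<noteq> 0} = {0, n}"
    using assms by (auto simp: betti_number_nsphere)
  then show ?thesis
    using assms by (simp add: top_euler_char_def betti_number_nsphere one_enat_def)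
qed

section \<open>Sign changes of the discrete sphere\<close>

text \<open>
  The restriction to the discrete sphere makes these maps extensional, as the elements of
  \<^const>\<open>BijGroup\<close> have to be.
\<close>

definition sign_change :: "nat \<Rightarrow> nat set \<Rightarrow> (nat \<Rightarrow> real) \<Rightarrow> (nat \<Rightarrow> real)" where
  "sign_change n A = (\<lambda>x \<in> discrete_sphere n. \<lambda>j. if j \<in> A then - x j else x j)"

lemma discrete_sphere_cases [consumes 1]:
  assumes "x \<in> discrete_sphere n"
  obtains i where "i \<le> n" "x = basis_vec i" | i where "i \<le> n" "x = neg_basis_vec i"
  using assms by (auto simp: discrete_sphere_def)

lemma basis_vec_in [simp]: "i \<le> n \<Longrightarrow> basis_vec i \<in> discrete_sphere n"
  and neg_basis_vec_in [simp]: "i \<le> n \<Longrightarrow> neg_basis_vec i \<in> discrete_sphere n"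
  by (auto simp: discrete_sphere_def)

lemma sign_change_basis_vec:
  assumes "i \<le> n"
  shows "sign_change n A (basis_vec i) = (if i \<in> A then neg_basis_vec i else basis_vec i)"
    and "sign_change n A (neg_basis_vec i) = (if i \<in> A then basis_vec i else neg_basis_vec i)"
  using assms by (auto simp: sign_change_def) (auto simp: basis_vec_def neg_basis_vec_def)

lemma sign_change_closed: "x \<in> discrete_sphere n \<Longrightarrow> sign_change n A x \<in> discrete_sphere n"
  by (erule discrete_sphere_cases) (auto simp: sign_change_basis_vec)

lemma compose_sign_change:
  "compose (discrete_sphere n) (sign_change n A) (sign_change n B) = sign_change n (sym_diff A B)"
proof
  fix x
  show "compose (discrete_sphere n) (sign_change n A) (sign_change n B) x = sign_change n (sym_diff A B) x"
  proof (cases "x \<in> discrete_sphere n")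
    case True
    then show ?thesis
      using sign_change_closed[OF True, of B]
      by (auto simp: compose_def sign_change_def fun_eq_iff)
  next
    case False
    then show ?thesis by (simp add: compose_def sign_change_def)
  qed
qed

lemma sign_change_empty: "sign_change n {} = (\<lambda>x \<in> discrete_sphere n. x)"
  by (simp add: sign_change_def)

lemma sign_change_in_Bij: "sign_change n A \<in> Bij (discrete_sphere n)"
proof -
  have "sign_change n A (sign_change n A x) = x" if "x \<in> discrete_sphere n" for x
    using that by (cases rule: discrete_sphere_cases) (auto simp: sign_change_basis_vec)
  then have "bij_betw (sign_change n A) (discrete_sphere n) (discrete_sphere n)"
    by (intro bij_betw_byWitness[where f' = "sign_change n A"]) (auto intro: sign_change_closed)
  then show ?thesis
    by (simp add: Bij_def sign_change_def)
qed

lemma mult_sign_change: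
  "sign_change n A \<otimes>\<^bsub>BijGroup (discrete_sphere n)\<^esub> sign_change n B = sign_change n (sym_diff A B)"
  by (simp add: BijGroup_def sign_change_in_Bij compose_sign_change)

lemma one_sign_change: "\<one>\<^bsub>BijGroup (discrete_sphere n)\<^esub> = sign_change n {}"
  by (simp add: BijGroup_def sign_change_empty)

lemma inv_sign_change:
  "inv\<^bsub>BijGroup (discrete_sphere n)\<^esub> (sign_change n A) = sign_change n A"
  by (rule group.inv_equality[OF group_BijGroup])
    (auto simp: mult_sign_change one_sign_change, simp_all add: BijGroup_def sign_change_in_Bij)

lemma restrict_sphere_sym:
  assumes "i \<le> n" "p = basis_vec i \<or> p = neg_basis_vec i"
  shows "restrict (sphere_sym n p) (discrete_sphere n) = sign_change n ({..n} - {i})"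
proof
  fix x
  have p: "sphere_sym n p = sphere_sym n (basis_vec i)"
    using assms sphere_sym_basis(1) by metis
  show "restrict (sphere_sym n p) (discrete_sphere n) x = sign_change n ({..n} - {i}) x"
  proof (cases "x \<in> discrete_sphere n")
    case True
    then show ?thesis
    proof (cases rule: discrete_sphere_cases)
      case (1 j)
      then show ?thesis
        using assms(1) p by (cases "j = i") (auto simp: sign_change_basis_vec sphere_sym_basis(2,4))
    next
      case (2 j)
      then show ?thesis
        using assms(1) p by (cases "j = i")
          (auto simp: sign_change_basis_vec sphere_sym_basis(3,5))
    qed
  next
    case False
    then show ?thesis by (simp add: sign_change_def)
  qed
qed

text \<open>
  The two complements \<open>{..n} - {i}\<close> and \<open>{..n} - {j}\<close> have the same symmetric difference as \<open>{i}\<close>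
  and \<open>{j}\<close>.
\<close>

lemma sphere_sym_mult_inv:
  assumes "i \<le> n" "p = basis_vec i \<or> p = neg_basis_vec i"
    and "j \<le> n" "q = basis_vec j \<or> q = neg_basis_vec j"
  shows "restrict (sphere_sym n p) (discrete_sphere n) \<otimes>\<^bsub>BijGroup (discrete_sphere n)\<^esub>
      inv\<^bsub>BijGroup (discrete_sphere n)\<^esub> (restrict (sphere_sym n q) (discrete_sphere n))
    = sign_change n (sym_diff {i} {j})"
proof -
  have "sym_diff ({..n} - {i}) ({..n} - {j}) = sym_diff {i} {j}"
    using assms(1,3) by auto
  then show ?thesis
    using restrict_sphere_sym[OF assms(1,2)] restrict_sphere_sym[OF assms(3,4)]
    by (simp only: inv_sign_change mult_sign_change)
qed

lemma even_card_sym_diff: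
  assumes "finite A" "finite B"
  shows "even (card (sym_diff A B)) \<longleftrightarrow> even (card A + card B)"
proof -
  have "card (sym_diff A B) = card (A - B) + card (B - A)"
    using assms by (intro card_Un_disjoint) auto
  moreover have "card A = card (A - B) + card (A \<inter> B)" "card B = card (B - A) + card (A \<inter> B)"
    using assms by (metis card_Diff_subset_Int card_Int_Diff add.commute Int_commute)+
  ultimately show ?thesis by presburger
qed

text \<open>
  The parity of the number of negated coordinates is invariant under composition, and the
  generators have even parity. Conversely, a nonempty set of even size is reached by splitting
  off pairs \<open>{i, j}\<close>, whose sign change is the generator given by \<open>e\<^sub>i\<close> and \<open>e\<^sub>j\<close>.
\<close>

theorem displacement_group_discrete_sphere:
  "displacement_group (discrete_sphere n) (sphere_sym n)
     = sign_change n ` {A. A \<subseteq> {..n} \<and> even (card A)}"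
    (is "?D = sign_change n ` ?E")
proof
  let ?X = "discrete_sphere n"
  let ?G = "BijGroup ?X"
  let ?S = "{restrict (sphere_sym n x) ?X \<otimes>\<^bsub>?G\<^esub> inv\<^bsub>?G\<^esub> (restrict (sphere_sym n y) ?X)
              | x y. x \<in> ?X \<and> y \<in> ?X}"
  have fin: "finite A" if "A \<in> ?E" for A
    using that by (auto intro: finite_subset)
  have E_sym_diff: "sym_diff A B \<in> ?E" if "A \<in> ?E" "B \<in> ?E" for A B
    using that even_card_sym_diff[OF fin fin, OF that] by auto
  have S: "g \<in> sign_change n ` ?E" if "g \<in> ?S" for g
  proof -
    from that obtain p q where pq: "p \<in> ?X" "q \<in> ?X"
      and g: "g = restrict (sphere_sym n p) ?X \<otimes>\<^bsub>?G\<^esub> inv\<^bsub>?G\<^esub> (restrict (sphere_sym n q) ?X)"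
      by blast
    obtain i where i: "i \<le> n" "p = basis_vec i \<or> p = neg_basis_vec i"
      using pq(1) by (auto simp: discrete_sphere_def)
    obtain j where j: "j \<le> n" "q = basis_vec j \<or> q = neg_basis_vec j"
      using pq(2) by (auto simp: discrete_sphere_def)
    have "sym_diff {i} {j} \<in> ?E"
      using i j even_card_sym_diff[of "{i}" "{j}"] by auto
    then show ?thesis
      unfolding g sphere_sym_mult_inv[OF i j] by (rule imageI)
  qed
  show "?D \<subseteq> sign_change n ` ?E"
  proof
    fix g assume "g \<in> ?D"
    then show "g \<in> sign_change n ` ?E"
      unfolding displacement_group_def
    proof (induction rule: generate.induct)
      case one
      then show ?case by (auto simp: one_sign_change)
    next
      case (incl h)
      then show ?case by (rule S)
    next
      case (inv h)
      then obtain A where "h = sign_change n A" "A \<in> ?E"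
        using S by blast
      then show ?case by (simp add: inv_sign_change)
    next
      case (eng g h)
      then obtain A B where "g = sign_change n A" "A \<in> ?E" "h = sign_change n B" "B \<in> ?E"
        by blast
      moreover from this have "sym_diff A B \<in> ?E"
        using E_sym_diff by blast
      ultimately show ?case
        by (simp only: mult_sign_change) (rule imageI)
    qed
  qed
  have pair: "sign_change n {i, j} \<in> ?D" if "i \<le> n" "j \<le> n" "i \<noteq> j" for i j
  proof -
    have "sign_change n {i, j} = sign_change n (sym_diff {i} {j})"
      using that(3) by (intro arg_cong[where f = "sign_change n"]) auto
    also have "\<dots> = restrict (sphere_sym n (basis_vec i)) ?X \<otimes>\<^bsub>?G\<^esub>
        inv\<^bsub>?G\<^esub> (restrict (sphere_sym n (basis_vec j)) ?X)"
      using that by (intro sphere_sym_mult_inv[symmetric]) auto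
    finally have "sign_change n {i, j} \<in> ?S"
      using basis_vec_in[OF that(1)] basis_vec_in[OF that(2)] by (intro CollectI exI conjI)
    then show ?thesis
      unfolding displacement_group_def by (rule generate.incl)
  qed
  have "sign_change n A \<in> ?D" if "A \<in> ?E" for A
    using fin[OF that] that
  proof (induction A rule: finite_psubset_induct)
    case (psubset A)
    show ?case
    proof (cases "A = {}")
      case True
      then show ?thesis
        using generate.one[of ?G ?S] by (simp only: displacement_group_def one_sign_change)
    next
      case False
      then obtain i where i: "i \<in> A" by blast
      have "A \<noteq> {i}" using psubset.prems by auto
      then obtain j where j: "j \<in> A" "i \<noteq> j" using i by blast
      have "card (A - {i, j}) = card A - 2"
        using i j psubset.hyps by (simp add: card_Diff_subset)
      then have "A - {i, j} \<in> ?E"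
        using psubset.prems by auto
      then have "sign_change n (A - {i, j}) \<in> ?D"
        using i by (intro psubset.IH) auto
      moreover have "sign_change n {i, j} \<in> ?D"
        using i j psubset.prems by (intro pair) auto
      ultimately have "sign_change n (A - {i, j}) \<otimes>\<^bsub>?G\<^esub> sign_change n {i, j} \<in> ?D"
        unfolding displacement_group_def by (rule generate.eng)
      moreover have "sym_diff (A - {i, j}) {i, j} = A"
        using i j by auto
      ultimately show ?thesis
        by (simp only: mult_sign_change)
    qed
  qed
  then show "sign_change n ` ?E \<subseteq> ?D" by blast
qed

section \<open>The quandle Euler characteristic\<close>

lemma basis_vec_eq_iff:
  "basis_vec i = basis_vec j \<longleftrightarrow> i = j"
  "neg_basis_vec i = neg_basis_vec j \<longleftrightarrow> i = j"
  "basis_vec i \<noteq> neg_basis_vec j"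
  "neg_basis_vec i \<noteq> basis_vec j"
proof -
  show "basis_vec i = basis_vec j \<longleftrightarrow> i = j"
    by (auto simp: basis_vec_def fun_eq_iff split: if_splits)
  show "neg_basis_vec i = neg_basis_vec j \<longleftrightarrow> i = j"
    by (auto simp: neg_basis_vec_def basis_vec_def fun_eq_iff split: if_splits)
  have "basis_vec i i \<noteq> neg_basis_vec j i" for i j
    by (simp add: neg_basis_vec_def basis_vec_def)
  then show "basis_vec i \<noteq> neg_basis_vec j" "neg_basis_vec i \<noteq> basis_vec j"
    by metis+
qed

lemma fixed_points_sign_change:
  "fixed_points (sign_change n A) (discrete_sphere n)
     = basis_vec ` ({..n} - A) \<union> neg_basis_vec ` ({..n} - A)"
  by (auto simp: fixed_points_def sign_change_basis_vec basis_vec_eq_iff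
      elim!: discrete_sphere_cases split: if_splits)

lemma ecard_fixed_points_sign_change:
  "ecard (fixed_points (sign_change n A) (discrete_sphere n)) = enat (2 * card ({..n} - A))"
proof -
  have "card (basis_vec ` ({..n} - A) \<union> neg_basis_vec ` ({..n} - A))
      = card (basis_vec ` ({..n} - A)) + card (neg_basis_vec ` ({..n} - A))"
    by (intro card_Un_disjoint) (auto simp: basis_vec_eq_iff)
  also have "\<dots> = 2 * card ({..n} - A)"
    by (simp add: card_image inj_on_def basis_vec_eq_iff)
  finally show ?thesis
    by (simp add: ecard_def fixed_points_sign_change)
qed

text \<open>
  The number of coordinates that a displacement spares has the parity of \<open>n + 1\<close>; it is thus at
  least \<open>0\<close> or \<open>1\<close>, and the displacement negating all other coordinates attains this bound.
\<close>

lemma quandle_euler_char_discrete_sphere: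
  "quandle_euler_char (discrete_sphere n) (sphere_sym n) = (if odd n then 0 else 2)"
proof -
  \<comment> \<open>The least number of spared coordinates.\<close>
  define m :: nat where "m = (if odd n then 0 else 1)"
  have eq: "quandle_euler_char (discrete_sphere n) (sphere_sym n)
      = (INF A \<in> {A. A \<subseteq> {..n} \<and> even (card A)}. enat (2 * card ({..n} - A)))"
    by (simp add: quandle_euler_char_def displacement_group_discrete_sphere image_image
        ecard_fixed_points_sign_change)
  have "(INF A \<in> {A. A \<subseteq> {..n} \<and> even (card A)}. enat (2 * card ({..n} - A))) = enat (2 * m)"
  proof (rule antisym)
    \<comment> \<open>Negating the coordinates from \<open>m\<close> on spares exactly \<open>m\<close> of them.\<close>
    have "{m..n} \<in> {A. A \<subseteq> {..n} \<and> even (card A)}"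
      by (auto simp: m_def)
    moreover have "{..n} - {m..n} = {..<m}"
      by (auto simp: m_def)
    ultimately show "(INF A \<in> {A. A \<subseteq> {..n} \<and> even (card A)}. enat (2 * card ({..n} - A))) \<le> enat (2 * m)"
      by (intro INF_lower2[of "{m..n}"]) auto
  next
    show "enat (2 * m) \<le> (INF A \<in> {A. A \<subseteq> {..n} \<and> even (card A)}. enat (2 * card ({..n} - A)))"
    proof (rule INF_greatest)
      fix A assume "A \<in> {A. A \<subseteq> {..n} \<and> even (card A)}"
      then have A: "A \<subseteq> {..n}" "even (card A)" by auto
      have "card ({..n} - A) + card A = Suc n"
        using A(1) by (metis card_Diff_subset card_atMost card_mono finite_atMost finite_subset le_add_diff_inverse2)
      then have "even n \<Longrightarrow> odd (card ({..n} - A))"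
        using A(2) by presburger
      then have "m \<le> card ({..n} - A)"
        by (auto simp: m_def intro: Suc_leI odd_pos)
      then show "enat (2 * m) \<le> enat (2 * card ({..n} - A))" by simp
    qed
  qed
  then show ?thesis
    unfolding eq by (simp add: m_def zero_enat_def numeral_eq_enat)
qed

theorem theorem1p6:
  fixes n :: nat
  assumes "n \<ge> 1"
  shows "ereal_of_enat (quandle_euler_char (discrete_sphere n) (sphere_sym n))
           = ereal (real_of_int (top_euler_char (nsphere n)))
       \<and> quandle_euler_char (discrete_sphere n) (sphere_sym n) = (if odd n then 0 else 2)"
proof -
  have "ereal_of_enat 2 = ereal 2"
    by (simp add: numeral_eq_enat)
  then show ?thesis
    by (simp add: quandle_euler_char_discrete_sphere top_euler_char_nsphere[OF assms])
qed

end
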